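(* Consider the parallel Cuckoo Heavy Keeper (either variant mCHK-I or mCHK-Q) with $P$ threads, per-item buffered weight cap $MAX\_W$, and underlying Cuckoo Heavy Keeper structures with $\mathcal{B}$ buckets per table. Assume that no fingerprint collisions occur and that the heavy part has sufficient space to accommodate promoted items without losing true heavy hitters during relocations. Let $N_s$ be the total weighted size of the processed stream at the start of a heavy-hitter query, let $e$ be any item in the heavy part, let $f_{N_s}(e)$ be the true frequency of $e$ in the stream up to $N_s$, and let $\mathbb{B}(e)$ (with $\mathbb{B}(e)\le P\cdot MAX\_W$) be the total weight of occurrences of $e$ that are buffered and not yet processed. Then for any $0<\epsilon<1$, the estimated frequency $\hat f(e)$ returned by the heavy-hitter query satisfies \[ \Pr\Bigl[\,\bigl|\hat f(e)-\bigl(f_{N_s}(e)-\mathbb{B}(e)\bigr)\bigr|\ge \epsilon N_s\,\Bigr]\;\le\;\frac{1}{\epsilon\,\mathcal{B}}. \]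
   Context: A stream consists of tuples $(e,w)$ (item $e$, positive integer weight $w$). Cuckoo Heavy Keeper (CHK) is a sequential heavy-hitter structure with two tables of $\mathcal{B}$ buckets each (items mapped by a random hash function uniformly and independently to buckets); each bucket has a lobby entry whose counter uses count-with-exponential-decay with base $b>1$ (each unit of colliding weight decrements counter $C$ with probability $b^{-C}$, replacing the occupant at $0$) and several heavy entries; lobby items reaching threshold $L$ are promoted (directly into an empty heavy entry, or with probability $(C-L)/(C^{heavy}_{min}-L)$ replacing the minimum heavy entry, taking its counter value, with the displaced entry relocated by cuckoo kick-outs); heavy counters are then incremented exactly by later weights. For this sequential structure one has, for any item $e$ in the heavy part after processing a stream of total weight $N$ with true frequency $f(e)$: $\Pr[|\hat f(e)-f(e)|\ge\epsilon N]\le 1/(\epsilon\mathcal{B})$. Parallel version: each of $P$ threads owns a disjoint part of the item universe (owner of $e$ is $hash(e)\bmod P$) and a local CHK instance. A thread receiving $(e,w)$ buffers it in a buffer destined for the owner thread; a buffer is handed to the owner when it reaches $MAX\_BUF$ entries or the buffered weight of some item reaches $MAX\_W$, and the owner applies the buffered weighted updates to its local CHK and adds the weights to a global processed-size counter. Heavy-hitter queries read the local CHK instances (mCHK-I) or a global table of items whose counts exceeded the threshold (mCHK-Q), returning estimated frequencies $\hat f(e)$ from the CHK counters.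
   Formalization: The bound 𝔹(e) ≤ P·MAX_W is stated under the condition that no thread buffers more than MAX_W of e, since a single tuple of large weight can overshoot the cap; the sequential error bound of the underlying structure is taken as given for all streams, and the main bound does not need the cap. *)

theory Defs
  imports "HOL-Probability.Probability"
begin

section \<open>Weighted streams\<close>

type_synonym 'a stream = "('a \<times> nat) list"

definition weight :: "'a stream \<Rightarrow> nat" where
  "weight S = sum_list (map snd S)"

definition freq :: "'a stream \<Rightarrow> 'a \<Rightarrow> nat" where
  "freq S x = sum_list (map snd (filter (\<lambda>p. fst p = x) S))"

section \<open>The sequential Cuckoo Heavy Keeper\<close>

text \<open>
  The two tables are indexed by \<^typ>\<open>bool\<close>. Entries store a fingerprint and a counter. The
  fingerprint type will be finite, and the hash functions act on fingerprints, so that a displaced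
  entry can be relocated without knowing its item. When no two items share a fingerprint this is a
  uniform and independent assignment of items to buckets.

  The field \<open>contend\<close> is the rule choosing, from the counters of the two candidate lobby entries,
  the one with which an item contends when it finds both of them occupied by other items. It is left
  arbitrary.
\<close>

record chk_params =
  buckets :: nat    \<comment> \<open>buckets per table\<close>
  slots :: nat      \<comment> \<open>heavy entries per bucket\<close>
  base :: real
  thr :: nat        \<comment> \<open>promotion threshold L\<close>
  kicks :: nat      \<comment> \<open>maximal number of kick-outs in a relocation\<close>
  contend :: "nat \<Rightarrow> nat \<Rightarrow> bool pmf"

definition valid_params :: "chk_params \<Rightarrow> bool" where
  "valid_params prm \<longleftrightarrow> 0 < buckets prm \<and> 0 < slots prm \<and> 1 < base prm \<and> 0 < thr prm"

type_synonym 'k entry = "'k \<times> nat"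
type_synonym 'k hash = "bool \<times> 'k \<Rightarrow> nat"

text \<open>
  An entry list of a heavy bucket has at most \<open>slots\<close> elements; missing elements are empty heavy
  entries. The field \<open>lost\<close> is not used by the algorithm; it records the fingerprints of entries
  that were ever dropped because a relocation ran out of kick-outs.
\<close>

record 'k chk =
  lobby :: "bool \<Rightarrow> nat \<Rightarrow> 'k entry option"
  heavy :: "bool \<Rightarrow> nat \<Rightarrow> 'k entry list"
  lost :: "'k set"

definition chk_empty :: "'k chk" where
  "chk_empty = \<lparr>lobby = (\<lambda>_ _. None), heavy = (\<lambda>_ _. []), lost = {}\<rparr>"

definition hash_pmf :: "chk_params \<Rightarrow> ('k::finite) hash pmf" where
  "hash_pmf prm = Pi_pmf UNIV 0 (\<lambda>_. pmf_of_set {..<buckets prm})"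

definition set_lobby :: "bool \<Rightarrow> nat \<Rightarrow> 'k entry option \<Rightarrow> 'k chk \<Rightarrow> 'k chk" where
  "set_lobby t i x s = s\<lparr>lobby := (lobby s)(t := (lobby s t)(i := x))\<rparr>"

definition set_heavy :: "bool \<Rightarrow> nat \<Rightarrow> 'k entry list \<Rightarrow> 'k chk \<Rightarrow> 'k chk" where
  "set_heavy t i xs s = s\<lparr>heavy := (heavy s)(t := (heavy s t)(i := xs))\<rparr>"

text \<open>
  Count-with-exponential-decay, one unit of the colliding weight at a time. The unit that brings the
  occupant's counter to 0 is the first one counted for the new occupant, and the units not
  yet spent are counted as well.
\<close>

fun decay :: "real \<Rightarrow> 'k \<Rightarrow> nat \<Rightarrow> 'k entry \<Rightarrow> 'k entry pmf" where
  "decay b k 0 (x, C) = return_pmf (x, C)"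
| "decay b k (Suc w) (x, C) =
     do { d \<leftarrow> bernoulli_pmf (1 / b ^ C);
          let C' = (if d then C - 1 else C);
          if C' = 0 then return_pmf (k, Suc w) else decay b k w (x, C') }"

text \<open>Cuckoo relocation of an entry into table \<open>t\<close>, with at most \<open>n\<close> further kick-outs.\<close>

primrec relocate ::
  "chk_params \<Rightarrow> 'k hash \<Rightarrow> nat \<Rightarrow> bool \<Rightarrow> 'k entry \<Rightarrow> 'k chk \<Rightarrow> 'k chk pmf" where
  "relocate prm h 0 t x s =
     (let i = h (t, fst x); xs = heavy s t i in
      if length xs < slots prm then return_pmf (set_heavy t i (xs @ [x]) s)
      else return_pmf (s\<lparr>lost := insert (fst x) (lost s)\<rparr>))"
| "relocate prm h (Suc n) t x s =
     (let i = h (t, fst x); xs = heavy s t i in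
      if length xs < slots prm then return_pmf (set_heavy t i (xs @ [x]) s)
      else do { j \<leftarrow> pmf_of_set {..<length xs};
                relocate prm h n (\<not> t) (xs ! j) (set_heavy t i (xs[j := x]) s) })"

text \<open>
  Promotion attempt for \<open>k\<close>, whose counter in the lobby of its bucket in table \<open>t\<close> is \<open>C\<close>.
  The expression \<open>(C - L) / (Cm - L)\<close> is a probability only if \<open>C \<le> Cm\<close>; if \<open>C\<close> has already
  reached the minimum \<open>Cm\<close> of the heavy entries, the promotion succeeds and keeps \<open>C\<close>.
\<close>

definition promote ::
  "chk_params \<Rightarrow> 'k hash \<Rightarrow> bool \<Rightarrow> 'k \<Rightarrow> nat \<Rightarrow> 'k chk \<Rightarrow> 'k chk pmf" where
  "promote prm h t k C s =
     (let i = h (t, k); xs = heavy s t i; s' = set_lobby t i None s in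
      if C < thr prm then return_pmf s
      else if length xs < slots prm then return_pmf (set_heavy t i (xs @ [(k, C)]) s')
      else
        let j = arg_min (\<lambda>j. snd (xs ! j)) (\<lambda>j. j < length xs);
            Cm = snd (xs ! j);
            p = (if Cm \<le> C then 1
                 else (real C - real (thr prm)) / (real Cm - real (thr prm)))
        in do { ok \<leftarrow> bernoulli_pmf p;
                if ok
                then relocate prm h (kicks prm) (\<not> t) (xs ! j)
                       (set_heavy t i (xs[j := (k, max C Cm)]) s')
                else return_pmf s })"

definition in_heavy :: "'k hash \<Rightarrow> 'k \<Rightarrow> 'k chk \<Rightarrow> bool \<Rightarrow> bool" where
  "in_heavy h k s t \<longleftrightarrow> k \<in> fst ` set (heavy s t (h (t, k)))"

definition in_lobby :: "'k hash \<Rightarrow> 'k \<Rightarrow> 'k chk \<Rightarrow> bool \<Rightarrow> bool" where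
  "in_lobby h k s t \<longleftrightarrow> (\<exists>C. lobby s t (h (t, k)) = Some (k, C))"

definition lobby_count :: "'k hash \<Rightarrow> 'k \<Rightarrow> 'k chk \<Rightarrow> bool \<Rightarrow> nat" where
  "lobby_count h k s t = snd (the (lobby s t (h (t, k))))"

definition chk_update ::
  "chk_params \<Rightarrow> 'k hash \<Rightarrow> 'k \<Rightarrow> nat \<Rightarrow> 'k chk \<Rightarrow> 'k chk pmf" where
  "chk_update prm h k w s =
     (let tabs = [False, True] in
      case find (in_heavy h k s) tabs of
        Some t \<Rightarrow>
          return_pmf (set_heavy t (h (t, k))
            (map (\<lambda>(x, C). (x, if x = k then C + w else C)) (heavy s t (h (t, k)))) s)
      | None \<Rightarrow>
      (case find (in_lobby h k s) tabs of
        Some t \<Rightarrow>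
          let C = lobby_count h k s t + w
          in promote prm h t k C (set_lobby t (h (t, k)) (Some (k, C)) s)
      | None \<Rightarrow>
      (case find (\<lambda>t. lobby s t (h (t, k)) = None) tabs of
        Some t \<Rightarrow> promote prm h t k w (set_lobby t (h (t, k)) (Some (k, w)) s)
      | None \<Rightarrow>
          do { t \<leftarrow> contend prm (lobby_count h k s False) (lobby_count h k s True);
               x \<leftarrow> decay (base prm) k w (the (lobby s t (h (t, k))));
               let s' = set_lobby t (h (t, k)) (Some x) s;
               if fst x = k then promote prm h t k (snd x) s' else return_pmf s' })))"

text \<open>The counter of \<open>k\<close> in the heavy part, if \<open>k\<close> is there.\<close>

definition heavy_count :: "'k hash \<Rightarrow> 'k chk \<Rightarrow> 'k \<Rightarrow> nat option" where
  "heavy_count h s k = map_of (heavy s False (h (False, k)) @ heavy s True (h (True, k))) k"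

primrec chk_process ::
  "chk_params \<Rightarrow> ('a \<Rightarrow> 'k) \<Rightarrow> 'k hash \<Rightarrow> 'a stream \<Rightarrow> 'k chk \<Rightarrow> 'k chk pmf" where
  "chk_process prm fp h [] s = return_pmf s"
| "chk_process prm fp h (p # S) s =
     bind_pmf (chk_update prm h (fp (fst p)) (snd p) s) (chk_process prm fp h S)"

definition chk_run ::
  "chk_params \<Rightarrow> ('a \<Rightarrow> 'k::finite) \<Rightarrow> 'a stream \<Rightarrow> ('k hash \<times> 'k chk) pmf" where
  "chk_run prm fp S =
     do { h \<leftarrow> hash_pmf prm;
          s \<leftarrow> chk_process prm fp h S chk_empty;
          return_pmf (h, s) }"

text \<open>
  The heavy part has sufficient space for \<open>S\<close>: almost surely, no relocation during the processing
  of \<open>S\<close> drops a true heavy hitter, i.e. an item with frequency at least \<open>\<phi>\<close> times the weight of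
  \<open>S\<close>. Other items may be dropped.
\<close>

definition sufficient_space ::
  "chk_params \<Rightarrow> ('a \<Rightarrow> 'k::finite) \<Rightarrow> real \<Rightarrow> 'a stream \<Rightarrow> bool" where
  "sufficient_space prm fp \<phi> S \<longleftrightarrow>
     (AE r in measure_pmf (chk_run prm fp S).
        \<forall>x. \<phi> * real (weight S) \<le> real (freq S x) \<longrightarrow> fp x \<notin> lost (snd r))"

definition no_collisions :: "('a \<Rightarrow> 'k) \<Rightarrow> 'a stream \<Rightarrow> 'a \<Rightarrow> bool" where
  "no_collisions fp S e \<longleftrightarrow> inj_on fp (insert e (fst ` set S))"

text \<open>
  The error bound of the sequential structure, for a stream satisfying the two standing assumptions
  and an item in the heavy part after the processing of the stream. Being in the heavy part is
  itself a random event, on which the probability is conditioned.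
\<close>

definition chk_error_bound ::
  "chk_params \<Rightarrow> ('a \<Rightarrow> 'k::finite) \<Rightarrow> real \<Rightarrow> bool" where
  "chk_error_bound prm fp \<phi> \<longleftrightarrow>
     (\<forall>S e \<epsilon>. (\<forall>p\<in>set S. 0 < snd p) \<longrightarrow> no_collisions fp S e \<longrightarrow>
        sufficient_space prm fp \<phi> S \<longrightarrow> 0 < \<epsilon> \<longrightarrow> \<epsilon> < 1 \<longrightarrow>
        \<P>(r in measure_pmf (chk_run prm fp S).
            \<epsilon> * real (weight S)
              \<le> \<bar>real (the (heavy_count (fst r) (snd r) (fp e))) - real (freq S e)\<bar>
          \<bar> heavy_count (fst r) (snd r) (fp e) \<noteq> None)
        \<le> 1 / (\<epsilon> * real (buckets prm)))"

section \<open>Buffering and hand-over between threads\<close>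

definition owner :: "nat \<Rightarrow> ('a \<Rightarrow> nat) \<Rightarrow> 'a \<Rightarrow> nat" where
  "owner P hsh x = hsh x mod P"

text \<open>
  The field \<open>bufs\<close> maps a receiving thread and an owner to the buffer between them (at most one
  entry per item); \<open>received\<close> is the stream received by all threads so far; \<open>applied\<close>
  lists the owners and contents of the buffers applied so far, in the order of application.
\<close>

record 'a par =
  bufs :: "nat \<Rightarrow> nat \<Rightarrow> 'a stream"
  received :: "'a stream"
  applied :: "(nat \<times> 'a stream) list"

fun add_buf :: "'a \<Rightarrow> nat \<Rightarrow> 'a stream \<Rightarrow> 'a stream" where
  "add_buf x w [] = [(x, w)]"
| "add_buf x w ((y, v) # ys) = (if y = x then (y, v + w) # ys else (y, v) # add_buf x w ys)"

definition handed_over :: "nat \<Rightarrow> nat \<Rightarrow> 'a stream \<Rightarrow> bool" where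
  "handed_over max_buf max_w ys \<longleftrightarrow> max_buf \<le> length ys \<or> (\<exists>p\<in>set ys. max_w \<le> snd p)"

text \<open>
  The states reachable under any input stream, any distribution of it to the \<open>P\<close> threads and any
  scheduling. An owner may apply a handed-over buffer with arbitrary delay; until then the
  receiving thread puts nothing into it.
\<close>

inductive par_reachable :: "nat \<Rightarrow> ('a \<Rightarrow> nat) \<Rightarrow> nat \<Rightarrow> nat \<Rightarrow> 'a par \<Rightarrow> bool"
  for P :: nat and hsh :: "'a \<Rightarrow> nat" and max_buf max_w :: nat where
  init: "par_reachable P hsh max_buf max_w
           \<lparr>bufs = (\<lambda>_ _. []), received = [], applied = []\<rparr>"
| receive: "\<lbrakk> par_reachable P hsh max_buf max_w st; t < P; 0 < w; i = owner P hsh x;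
      \<not> handed_over max_buf max_w (bufs st t i) \<rbrakk> \<Longrightarrow>
    par_reachable P hsh max_buf max_w
      (st\<lparr>bufs := (bufs st)(t := (bufs st t)(i := add_buf x w (bufs st t i))),
          received := received st @ [(x, w)]\<rparr>)"
| deliver: "\<lbrakk> par_reachable P hsh max_buf max_w st; t < P; i < P;
      handed_over max_buf max_w (bufs st t i) \<rbrakk> \<Longrightarrow>
    par_reachable P hsh max_buf max_w
      (st\<lparr>bufs := (bufs st)(t := (bufs st t)(i := [])),
          applied := applied st @ [(i, bufs st t i)]\<rparr>)"

definition processed_size :: "'a par \<Rightarrow> nat" where
  "processed_size st = weight (concat (map snd (applied st)))"

definition buffered_by :: "nat \<Rightarrow> 'a par \<Rightarrow> nat \<Rightarrow> 'a \<Rightarrow> nat" where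
  "buffered_by P st t x = (\<Sum>i<P. freq (bufs st t i) x)"

definition buffered :: "nat \<Rightarrow> 'a par \<Rightarrow> 'a \<Rightarrow> nat" where
  "buffered P st x = (\<Sum>t<P. buffered_by P st t x)"

definition local_stream :: "'a par \<Rightarrow> nat \<Rightarrow> 'a stream" where
  "local_stream st i = concat (map snd (filter (\<lambda>b. fst b = i) (applied st)))"

section \<open>The parallel Cuckoo Heavy Keeper\<close>

datatype variant = MCHK_I | MCHK_Q

record ('a, 'k) mchk =
  hashes :: "nat \<Rightarrow> 'k hash"
  cells :: "nat \<Rightarrow> 'k chk"
  size_ctr :: nat
  hh_table :: "'a \<Rightarrow> nat option"

definition local_count ::
  "nat \<Rightarrow> ('a \<Rightarrow> nat) \<Rightarrow> ('a \<Rightarrow> 'k) \<Rightarrow> ('a, 'k) mchk \<Rightarrow> 'a \<Rightarrow> nat option" where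
  "local_count P hsh fp m x =
     (let i = owner P hsh x in heavy_count (hashes m i) (cells m i) (fp x))"

text \<open>
  Variant Q: after an update of \<open>x\<close>, the global table gets the current counter of \<open>x\<close> if that
  counter reaches the threshold or \<open>x\<close> is already in the table.
\<close>

definition refresh_table ::
  "nat \<Rightarrow> ('a \<Rightarrow> nat) \<Rightarrow> ('a \<Rightarrow> 'k) \<Rightarrow> real \<Rightarrow> 'a \<Rightarrow> ('a, 'k) mchk \<Rightarrow> ('a, 'k) mchk" where
  "refresh_table P hsh fp \<phi> x m = m\<lparr>hh_table := (hh_table m)(x :=
     (case local_count P hsh fp m x of
        None \<Rightarrow> None
      | Some c \<Rightarrow>
          if \<phi> * real (size_ctr m) \<le> real c \<or> hh_table m x \<noteq> None then Some c else None))\<rparr>"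

primrec apply_updates ::
  "variant \<Rightarrow> nat \<Rightarrow> ('a \<Rightarrow> nat) \<Rightarrow> chk_params \<Rightarrow> ('a \<Rightarrow> 'k) \<Rightarrow> real \<Rightarrow> nat \<Rightarrow> 'a stream
   \<Rightarrow> ('a, 'k) mchk \<Rightarrow> ('a, 'k) mchk pmf" where
  "apply_updates v P hsh prm fp \<phi> i [] m = return_pmf m"
| "apply_updates v P hsh prm fp \<phi> i (p # S) m =
     do { s \<leftarrow> chk_update prm (hashes m i) (fp (fst p)) (snd p) (cells m i);
          let m' = m\<lparr>cells := (cells m)(i := s)\<rparr>;
          apply_updates v P hsh prm fp \<phi> i S
            (case v of MCHK_I \<Rightarrow> m' | MCHK_Q \<Rightarrow> refresh_table P hsh fp \<phi> (fst p) m') }"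

primrec apply_buffers ::
  "variant \<Rightarrow> nat \<Rightarrow> ('a \<Rightarrow> nat) \<Rightarrow> chk_params \<Rightarrow> ('a \<Rightarrow> 'k) \<Rightarrow> real \<Rightarrow> (nat \<times> 'a stream) list
   \<Rightarrow> ('a, 'k) mchk \<Rightarrow> ('a, 'k) mchk pmf" where
  "apply_buffers v P hsh prm fp \<phi> [] m = return_pmf m"
| "apply_buffers v P hsh prm fp \<phi> (b # bs) m =
     bind_pmf
       (apply_updates v P hsh prm fp \<phi> (fst b) (snd b)
          (m\<lparr>size_ctr := size_ctr m + weight (snd b)\<rparr>))
       (apply_buffers v P hsh prm fp \<phi> bs)"

definition mchk_run ::
  "variant \<Rightarrow> nat \<Rightarrow> ('a \<Rightarrow> nat) \<Rightarrow> chk_params \<Rightarrow> ('a \<Rightarrow> 'k::finite) \<Rightarrow> real \<Rightarrow> 'a par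
   \<Rightarrow> ('a, 'k) mchk pmf" where
  "mchk_run v P hsh prm fp \<phi> st =
     do { hs \<leftarrow> Pi_pmf {..<P} (\<lambda>_. 0) (\<lambda>_. hash_pmf prm);
          apply_buffers v P hsh prm fp \<phi> (applied st)
            \<lparr>hashes = hs, cells = (\<lambda>_. chk_empty), size_ctr = 0, hh_table = (\<lambda>_. None)\<rparr> }"

text \<open>
  The answer to a heavy-hitter query with threshold \<open>\<theta>\<close>, as the partial map from the returned items
  to their estimated frequencies.
\<close>

definition hh_query ::
  "variant \<Rightarrow> nat \<Rightarrow> ('a \<Rightarrow> nat) \<Rightarrow> ('a \<Rightarrow> 'k) \<Rightarrow> real \<Rightarrow> ('a, 'k) mchk \<Rightarrow> 'a \<Rightarrow> nat option" where
  "hh_query v P hsh fp \<theta> m x =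
     (case (case v of MCHK_I \<Rightarrow> local_count P hsh fp m x | MCHK_Q \<Rightarrow> hh_table m x) of
        None \<Rightarrow> None
      | Some c \<Rightarrow> if \<theta> * real (size_ctr m) \<le> real c then Some c else None)"

end

theory Submission
  imports Defs
begin

text \<open>
  The local structure of the owner of an item is a sequential structure that has processed the
  substream of the buffers applied by that owner, so its pair of hash function and state has exactly
  the law of \<^const>\<open>chk_run\<close>. Every occurrence of the item is either still buffered or in that
  substream, which is no heavier than the whole processed stream; hence the error event is contained
  in the sequential one. For variant Q one also needs that the table is never stale while the item
  is in the heavy part: updates of other items only move or drop its unique heavy entry, and its own
  updates refresh the table.
\<close>

section \<open>Heavy entries of a key\<close>

abbreviation of_key :: "'k \<Rightarrow> 'k entry multiset \<Rightarrow> 'k entry multiset" where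
  "of_key k \<equiv> filter_mset (\<lambda>p. fst p = k)"

text \<open>The entries with key \<open>k\<close> in the two buckets where a lookup of
  \<open>k\<close> searches. A multiset forgets positions, so moving an entry between its two
  buckets leaves the value unchanged and dropping one gives a submultiset.\<close>

definition key_entries :: "'k hash \<Rightarrow> 'k \<Rightarrow> 'k chk \<Rightarrow> 'k entry multiset" where
  "key_entries h k s =
     of_key k (mset (heavy s False (h (False, k))) + mset (heavy s True (h (True, k))))"

text \<open>Ensures that \<open>key_entries\<close> sees every heavy entry of \<open>k\<close>: no
  entry hides in a foreign bucket, from which a kick-out could bring it back into view.\<close>

definition well_placed :: "'k hash \<Rightarrow> 'k \<Rightarrow> 'k chk \<Rightarrow> bool" where
  "well_placed h k s \<longleftrightarrow> (\<forall>t i. k \<in> fst ` set (heavy s t i) \<longrightarrow> i = h (t, k))"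

section \<open>Elementary writes to lobby and heavy part\<close>

lemma chk_empty_entries [simp]:
  "key_entries h k chk_empty = {#}" "well_placed h k chk_empty"
  by (simp_all add: key_entries_def well_placed_def chk_empty_def)

lemma set_lobby_entries [simp]:
  "heavy (set_lobby t i x s) = heavy s"
  "key_entries h k (set_lobby t i x s) = key_entries h k s"
  "well_placed h k (set_lobby t i x s) = well_placed h k s"
  by (simp_all add: key_entries_def well_placed_def set_lobby_def)

lemma lost_update_entries [simp]:
  "key_entries h k (s\<lparr>lost := A\<rparr>) = key_entries h k s"
  "well_placed h k (s\<lparr>lost := A\<rparr>) = well_placed h k s"
  by (simp_all add: key_entries_def well_placed_def)

lemma of_key_eq_empty: "k \<notin> fst ` set xs \<Longrightarrow> of_key k (mset xs) = {#}"
  by (induction xs) auto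

lemma well_placed_set_heavy:
  assumes "well_placed h k s" "k \<in> fst ` set ys \<longrightarrow> i = h (t, k)"
  shows "well_placed h k (set_heavy t i ys s)"
  using assms by (auto simp: well_placed_def set_heavy_def)

text \<open>A balance equation, with the old bucket contents on the left, avoids truncated multiset
  subtraction; the common part is cancelled later. If the bucket is not one of those of
  \<open>k\<close>, neither its old nor its new contents mention \<open>k\<close>.\<close>

lemma key_entries_set_heavy:
  assumes "well_placed h k s" "k \<in> fst ` set ys \<longrightarrow> i = h (t, k)"
  shows "key_entries h k (set_heavy t i ys s) + of_key k (mset (heavy s t i)) =
         key_entries h k s + of_key k (mset ys)"
proof (cases "i = h (t, k)")
  case True
  then show ?thesis
    by (cases t) (auto simp: key_entries_def set_heavy_def ac_simps)
next
  case False
  with assms have "k \<notin> fst ` set ys" "k \<notin> fst ` set (heavy s t i)"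
    by (auto simp: well_placed_def)
  note this[THEN of_key_eq_empty]
  moreover have "key_entries h k (set_heavy t i ys s) = key_entries h k s"
    using False by (cases t) (auto simp: key_entries_def set_heavy_def)
  ultimately show ?thesis by (simp only:)
qed

lemma set_heavy_append:
  assumes "well_placed h k s" "i = h (t, fst x)"
  shows "well_placed h k (set_heavy t i (heavy s t i @ [x]) s)"
    and "key_entries h k (set_heavy t i (heavy s t i @ [x]) s) =
         key_entries h k s + of_key k {#x#}"
proof -
  have *: "k \<in> fst ` set (heavy s t i @ [x]) \<longrightarrow> i = h (t, k)"
    using assms by (auto simp: well_placed_def)
  show "well_placed h k (set_heavy t i (heavy s t i @ [x]) s)"
    using assms(1) * by (rule well_placed_set_heavy)
  have "key_entries h k (set_heavy t i (heavy s t i @ [x]) s) + of_key k (mset (heavy s t i)) =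
        (key_entries h k s + of_key k {#x#}) + of_key k (mset (heavy s t i))"
    using key_entries_set_heavy[OF assms(1) *] by (simp add: ac_simps)
  then show "key_entries h k (set_heavy t i (heavy s t i @ [x]) s) =
         key_entries h k s + of_key k {#x#}"
    by (rule add_right_imp_eq)
qed

text \<open>One kick-out conserves the entries of \<open>k\<close> in the structure together with
  the entry in hand: \<open>x\<close> goes in and the displaced entry comes out.\<close>

lemma set_heavy_list_update:
  assumes "well_placed h k s" "i = h (t, fst x)" "j < length (heavy s t i)"
  shows "well_placed h k (set_heavy t i ((heavy s t i)[j := x]) s)"
    and "key_entries h k (set_heavy t i ((heavy s t i)[j := x]) s) +
         of_key k {#heavy s t i ! j#} = key_entries h k s + of_key k {#x#}"
proof -
  let ?xs = "heavy s t i" and ?s' = "set_heavy t i ((heavy s t i)[j := x]) s"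
  have *: "k \<in> fst ` set (?xs[j := x]) \<longrightarrow> i = h (t, k)"
  proof
    assume "k \<in> fst ` set (?xs[j := x])"
    then have "k = fst x \<or> k \<in> fst ` set ?xs"
      using set_update_subset_insert[of ?xs j x] by blast
    with assms(1,2) show "i = h (t, k)" by (auto simp: well_placed_def)
  qed
  show "well_placed h k ?s'"
    using assms(1) * by (rule well_placed_set_heavy)
  have "add_mset x (mset ?xs) = add_mset (?xs ! j) (mset (?xs[j := x]))"
    using assms(3) by (simp add: mset_update)
  then have upd: "of_key k {#x#} + of_key k (mset ?xs) =
      of_key k {#?xs ! j#} + of_key k (mset (?xs[j := x]))"
    by (metis add_mset_add_single filter_union_mset union_commute)
  have "(key_entries h k ?s' + of_key k {#?xs ! j#}) + of_key k (mset ?xs) =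
        (key_entries h k ?s' + of_key k (mset ?xs)) + of_key k {#?xs ! j#}"
    by (simp only: ac_simps)
  also have "\<dots> = key_entries h k s + (of_key k {#?xs ! j#} + of_key k (mset (?xs[j := x])))"
    unfolding key_entries_set_heavy[OF assms(1) *] by (simp only: ac_simps)
  also have "\<dots> = (key_entries h k s + of_key k {#x#}) + of_key k (mset ?xs)"
    unfolding upd[symmetric] by (simp only: ac_simps)
  finally show "key_entries h k ?s' + of_key k {#?xs ! j#} = key_entries h k s + of_key k {#x#}"
    by (rule add_right_imp_eq)
qed

text \<open>Structure plus entry in hand is conserved by each kick-out. Only running out of
  kick-outs can lose the entry in hand, hence inclusion instead of equality.\<close>

lemma relocate_entries:
  assumes "well_placed h k s" "0 < slots prm" "s' \<in> set_pmf (relocate prm h n t x s)"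
  shows "well_placed h k s' \<and> key_entries h k s' \<subseteq># key_entries h k s + of_key k {#x#}"
  using assms(1,3)
proof (induction n arbitrary: t x s)
  case 0
  then show ?case
    by (auto simp: Let_def set_heavy_append simp del: filter_mset_add_mset split: if_splits)
next
  case (Suc n)
  let ?i = "h (t, fst x)"
  let ?xs = "heavy s t ?i"
  show ?case
  proof (cases "length ?xs < slots prm")
    case True
    with Suc.prems show ?thesis
      by (auto simp: Let_def set_heavy_append simp del: filter_mset_add_mset)
  next
    case False
    \<comment> \<open>A full bucket is nonempty because there is at least one slot, so the uniform
      choice of a victim has exactly the valid indices as its support.\<close>
    with assms(2) have "?xs \<noteq> []" by auto
    then have "{..<length ?xs} \<noteq> {}" by (simp add: lessThan_empty_iff)
    with False Suc.prems(2) obtain j where j: "j < length ?xs"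
      and s': "s' \<in> set_pmf (relocate prm h n (\<not> t) (?xs ! j) (set_heavy t ?i (?xs[j := x]) s))"
      by (auto simp: Let_def)
    note upd = set_heavy_list_update[OF Suc.prems(1) refl j]
    show ?thesis
      using Suc.IH[OF upd(1) s'] unfolding upd(2) .
  qed
qed

text \<open>The stored counter may be \<open>C\<close> or the inherited minimum, so it is left
  existential; only the key matters. For \<open>k\<close> different from \<open>x\<close> nothing is
  gained, and for \<open>k\<close> equal to \<open>x\<close> at most one entry is.\<close>

lemma promote_entries:
  assumes "well_placed h k s" "0 < slots prm" "s' \<in> set_pmf (promote prm h t x C s)"
  shows "well_placed h k s' \<and>
         (\<exists>C'. key_entries h k s' \<subseteq># key_entries h k s + of_key k {#(x, C')#})"
proof -
  let ?i = "h (t, x)"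
  let ?s = "set_lobby t ?i None s"
  let ?xs = "heavy s t ?i"
  let ?j = "arg_min (\<lambda>j. snd (?xs ! j)) (\<lambda>j. j < length ?xs)"
  let ?u = "\<lambda>C'. set_heavy t ?i (?xs[?j := (x, C')]) ?s"
  have wp: "well_placed h k ?s" using assms(1) by simp
  \<comment> \<open>Only the support of the coin is inspected, so the value of the acceptance
    probability drops out.\<close>
  have "s' = s \<or> s' \<in> set_pmf (relocate prm h (kicks prm) (\<not> t) (?xs ! ?j)
      (?u (max C (snd (?xs ! ?j)))))" if "\<not> C < thr prm" "\<not> length ?xs < slots prm"
    using assms(3) that unfolding promote_def Let_def
    by (auto simp only: set_bind_pmf set_return_pmf if_False split: if_splits)
  moreover have "s' = s" if "C < thr prm"
    using assms(3) that by (simp add: promote_def)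
  moreover have "s' = set_heavy t ?i (?xs @ [(x, C)]) ?s"
    if "\<not> C < thr prm" "length ?xs < slots prm"
    using assms(3) that by (simp add: promote_def Let_def)
  ultimately consider "s' = s" | "s' = set_heavy t ?i (?xs @ [(x, C)]) ?s"
    | C' where "\<not> length ?xs < slots prm"
        "s' \<in> set_pmf (relocate prm h (kicks prm) (\<not> t) (?xs ! ?j) (?u C'))"
    by blast
  then show ?thesis
  proof cases
    case 1
    \<comment> \<open>Nothing was written to the heavy part, so any counter serves as a
      witness.\<close>
    with assms(1) show ?thesis by (auto intro!: exI[of _ 0])
  next
    case 2
    then show ?thesis
      using set_heavy_append[OF wp, of ?i t "(x, C)"] by (auto intro!: exI[of _ C])
  next
    case 3
    \<comment> \<open>The minimum is taken over a nonempty index set, which makes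
      \<open>arg_min\<close> a genuine position.\<close>
    with assms(2) have "0 < length ?xs" by linarith
    then have "?j < length ?xs" by (rule conjunct1[OF arg_min_nat_lemma])
    then have j: "?j < length (heavy ?s t ?i)" by simp
    have i: "?i = h (t, fst (x, C'))" by simp
    note upd = set_heavy_list_update[OF wp i j, unfolded set_lobby_entries]
    show ?thesis
      using relocate_entries[OF upd(1) assms(2) 3(2)] unfolding upd(2) by blast
  qed
qed

section \<open>One update, seen from a fixed key\<close>

lemma key_entries_eq_empty:
  assumes "\<And>t. \<not> in_heavy h k s t"
  shows "key_entries h k s = {#}"
  using assms[of False] assms[of True]
  by (simp add: key_entries_def in_heavy_def of_key_eq_empty)

lemma find_tabs_None: "find Q [False, True] = None \<longleftrightarrow> (\<forall>t. \<not> Q t)"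
  by (metis (full_types) find_None_iff list.set_intros)

text \<open>Reduces the algorithm to what concerns the heavy part. The \<open>promote\<close> case
  merges three routes: \<open>x\<close> already in a lobby, an empty lobby entry, and a lobby entry
  won by decay. Promotion and decay retain that \<open>x\<close> is in neither heavy bucket.\<close>

lemma chk_update_cases:
  assumes "s' \<in> set_pmf (chk_update prm h x w s)"
  obtains (heavy) t where "in_heavy h x s t"
      "s' = set_heavy t (h (t, x))
        (map (\<lambda>(y, C). (y, if y = x then C + w else C)) (heavy s t (h (t, x)))) s"
    | (promote) t l C where "\<And>t. \<not> in_heavy h x s t"
      "s' \<in> set_pmf (promote prm h t x C (set_lobby t (h (t, x)) l s))"
    | (decay) t l where "\<And>t. \<not> in_heavy h x s t" "s' = set_lobby t (h (t, x)) l s"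
proof (cases "find (in_heavy h x s) [False, True]")
  case (Some t)
  then have "in_heavy h x s t" by (auto split: if_splits)
  with Some assms heavy show ?thesis by (simp add: chk_update_def)
next
  case None
  then have nh: "\<And>t. \<not> in_heavy h x s t" unfolding find_tabs_None by blast
  note s' = assms[unfolded chk_update_def Let_def None option.case]
  show ?thesis
  proof (cases "find (in_lobby h x s) [False, True]")
    case (Some t)
    then show ?thesis
      using s'[unfolded Some option.case] by (intro promote[OF nh])
  next
    case no_lobby: None
    note s' = s'[unfolded no_lobby option.case]
    show ?thesis
    proof (cases "find (\<lambda>t. lobby s t (h (t, x)) = None) [False, True]")
      case (Some t)
      then show ?thesis
        using s'[unfolded Some option.case] by (intro promote[OF nh])
    next
      case None
      obtain t y where "s' \<in> set_pmf (if fst y = x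
          then promote prm h t x (snd y) (set_lobby t (h (t, x)) (Some y) s)
          else return_pmf (set_lobby t (h (t, x)) (Some y) s))"
        using s'[unfolded None option.case] unfolding set_bind_pmf by blast
      then show ?thesis
        using promote[OF nh] decay[OF nh] by (cases "fst y = x") auto
    qed
  qed
qed

text \<open>An update of \<open>x\<close> increments or inserts only entries with key
  \<open>x\<close>, which the filter for \<open>k\<close> discards. Entries of \<open>k\<close> can
  thus be moved or dropped, but neither changed nor created.\<close>

lemma chk_update_other_key:
  assumes "well_placed h k s" "0 < slots prm" "s' \<in> set_pmf (chk_update prm h x w s)" "x \<noteq> k"
  shows "well_placed h k s' \<and> key_entries h k s' \<subseteq># key_entries h k s"
  using assms(3)
proof (cases rule: chk_update_cases)
  case (heavy t)
  let ?xs = "heavy s t (h (t, x))"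
  let ?ys = "map (\<lambda>(y, C). (y, if y = x then C + w else C)) ?xs"
  have keys: "fst ` set ?ys = fst ` set ?xs"
    by (force simp: image_iff)
  have place: "k \<in> fst ` set ?ys \<longrightarrow> h (t, x) = h (t, k)"
    using assms(1) unfolding keys well_placed_def by blast
  have "of_key k (mset (map (\<lambda>(y, C). (y, if y = x then C + w else C)) xs)) = of_key k (mset xs)"
    for xs
    using assms(4) by (induction xs) auto
  then show ?thesis
    using key_entries_set_heavy[OF assms(1) place] well_placed_set_heavy[OF assms(1) place] heavy
    by simp
next
  case (promote t l C)
  then show ?thesis
    using promote_entries[of h k "set_lobby t (h (t, x)) l s" prm s' t x C] assms by auto
next
  case (decay t l)
  with assms show ?thesis by simp
qed

text \<open>Keeps the heavy entry of \<open>k\<close> unique: an increment does not alter the number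
  of entries, and a promotion is attempted only when there are none, adding at most one.\<close>

lemma chk_update_own_key:
  assumes "well_placed h k s" "0 < slots prm" "s' \<in> set_pmf (chk_update prm h k w s)"
    "size (key_entries h k s) \<le> 1"
  shows "well_placed h k s' \<and> size (key_entries h k s') \<le> 1"
  using assms(3)
proof (cases rule: chk_update_cases)
  case (heavy t)
  let ?xs = "heavy s t (h (t, k))"
  let ?ys = "map (\<lambda>(y, C). (y, if y = k then C + w else C)) ?xs"
  have "size (of_key k (mset (map (\<lambda>(y, C). (y, if y = k then C + w else C)) xs))) =
      size (of_key k (mset xs))" for xs
    by (induction xs) auto
  then have "size (key_entries h k s') = size (key_entries h k s)"
    using arg_cong[OF key_entries_set_heavy[OF assms(1), of ?ys "h (t, k)" t], of size] heavy
    by simp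
  then show ?thesis
    using well_placed_set_heavy[OF assms(1)] heavy assms(4) by simp
next
  case (promote t l C)
  then obtain C' where "well_placed h k s'" "key_entries h k s' \<subseteq># of_key k {#(k, C')#}"
    using promote_entries[of h k "set_lobby t (h (t, k)) l s" prm s' t k C] assms
    by (auto simp: key_entries_eq_empty)
  then show ?thesis
    using size_mset_mono[of "key_entries h k s'"] by fastforce
next
  case (decay t l)
  with assms show ?thesis by simp
qed

section \<open>Reading a counter off the entries\<close>

lemma heavy_count_in_key_entries: "heavy_count h s k = Some c \<Longrightarrow> (k, c) \<in># key_entries h k s"
  unfolding heavy_count_def key_entries_def by (drule map_of_SomeD) auto

lemma heavy_count_eq_None_iff: "heavy_count h s k = None \<longleftrightarrow> key_entries h k s = {#}"
  unfolding heavy_count_def key_entries_def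
  by (force simp: map_of_eq_None_iff)

text \<open>With at most one entry before, an entry that survives is that very entry, with the same
  counter. This is why a table value stays correct under updates of other items.\<close>

lemma heavy_count_antimono:
  assumes "size (key_entries h k s) \<le> 1" "key_entries h k s' \<subseteq># key_entries h k s"
    "heavy_count h s' k = Some c"
  shows "heavy_count h s k = Some c"
proof -
  have c: "(k, c) \<in># key_entries h k s"
    using heavy_count_in_key_entries[OF assms(3)] assms(2) by (rule mset_subset_eqD[rotated])
  then obtain d where d: "heavy_count h s k = Some d"
    using heavy_count_eq_None_iff[of h s k] by fastforce
  obtain a where "key_entries h k s = {#a#}"
    using assms(1) c by (cases "key_entries h k s") auto
  with c heavy_count_in_key_entries[OF d] have "c = d" by auto
  with d show ?thesis by simp
qed

section \<open>Buffering\<close>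

lemma freq_simps [simp]:
  "freq [] x = 0" "freq (p # S) x = (if fst p = x then snd p else 0) + freq S x"
  "freq (S @ T) x = freq S x + freq T x"
  by (simp_all add: freq_def)

lemma weight_simps [simp]:
  "weight [] = 0" "weight (p # S) = snd p + weight S" "weight (S @ T) = weight S + weight T"
  by (simp_all add: weight_def)

lemma freq_eq_0: "x \<notin> fst ` set S \<Longrightarrow> freq S x = 0"
  by (induction S) auto

lemma freq_add_buf: "freq (add_buf y w ys) x = freq ys x + (if y = x then w else 0)"
  by (induction y w ys rule: add_buf.induct) auto

lemma add_buf_memE:
  assumes "p \<in> set (add_buf x w ys)"
  obtains v where "p = (x, v)" "w \<le> v" | "p \<in> set ys"
  using assms by (induction x w ys rule: add_buf.induct) (auto split: if_splits)

text \<open>Receiving and delivering both replace a single buffer; the balance form covers both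
  without truncated subtraction on naturals.\<close>

lemma buffered_update:
  assumes "t < P" "i < P"
  shows "buffered P (st\<lparr>bufs := (bufs st)(t := (bufs st t)(i := ys))\<rparr>) x + freq (bufs st t i) x =
         buffered P st x + freq ys x"
proof -
  let ?st = "st\<lparr>bufs := (bufs st)(t := (bufs st t)(i := ys))\<rparr>"
  have other: "buffered_by P ?st u x = buffered_by P st u x" if "u \<noteq> t" for u
    using that by (simp add: buffered_by_def)
  have "buffered_by P ?st t x + freq (bufs st t i) x = buffered_by P st t x + freq ys x"
    using assms(2) by (simp add: buffered_by_def sum.remove[of _ i])
  then show ?thesis
    using assms(1) other by (simp add: buffered_def sum.remove[of _ t])
qed

text \<open>Ownership places all processed weight of an item in one local stream, positivity is a
  premise of the sequential bound, and occurrence in \<open>R\<close> lets the absence of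
  fingerprint collisions pass from \<open>R\<close> to the buffers.\<close>

definition routed :: "nat \<Rightarrow> ('a \<Rightarrow> nat) \<Rightarrow> 'a stream \<Rightarrow> nat \<Rightarrow> 'a stream \<Rightarrow> bool" where
  "routed P hsh R i ys \<longleftrightarrow> (\<forall>p\<in>set ys. owner P hsh (fst p) = i \<and> 0 < snd p \<and> fst p \<in> fst ` set R)"

lemma routed_Nil [simp]: "routed P hsh R i []"
  by (simp add: routed_def)

lemma routed_append: "routed P hsh R i ys \<Longrightarrow> routed P hsh (R @ R') i ys"
  by (auto simp: routed_def)

lemma routed_add_buf:
  assumes "routed P hsh R i ys" "0 < w" "i = owner P hsh x"
  shows "routed P hsh (R @ [(x, w)]) i (add_buf x w ys)"
  unfolding routed_def
proof
  fix p assume "p \<in> set (add_buf x w ys)"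
  then show "owner P hsh (fst p) = i \<and> 0 < snd p \<and> fst p \<in> fst ` set (R @ [(x, w)])"
    by (cases rule: add_buf_memE) (use assms in \<open>auto simp: routed_def\<close>)
qed

lemma par_reachable_routed:
  assumes "par_reachable P hsh max_buf max_w st"
  shows "routed P hsh (received st) i (bufs st t i) \<and>
         (\<forall>b\<in>set (applied st). routed P hsh (received st) (fst b) (snd b))"
  using assms by (induction arbitrary: t i) (auto intro: routed_append routed_add_buf)

text \<open>Conservation of weight: a receipt raises both sides by the same amount, and a delivery
  moves weight from the buffers to the applied part.\<close>

lemma par_reachable_freq:
  assumes "par_reachable P hsh max_buf max_w st" "0 < P"
  shows "freq (received st) x = buffered P st x + freq (concat (map snd (applied st))) x"
  using assms(1)
proof induction
  case init
  then show ?case by (simp add: buffered_def buffered_by_def)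
next
  case (receive st t w i y)
  let ?st = "st\<lparr>bufs := (bufs st)(t := (bufs st t)(i := add_buf y w (bufs st t i)))\<rparr>"
  \<comment> \<open>\<open>buffered\<close> sums over owners below \<open>P\<close> only, so the
    buffer written to must have such an index; this uses that \<open>P\<close> is positive.\<close>
  have "i < P" using receive assms(2) by (simp add: owner_def)
  moreover have "buffered P (?st\<lparr>received := received st @ [(y, w)]\<rparr>) x = buffered P ?st x"
    by (simp add: buffered_def buffered_by_def)
  ultimately show ?case
    using receive buffered_update[of t P i st "add_buf y w (bufs st t i)" x]
    by (simp add: freq_add_buf)
next
  case (deliver st t i)
  let ?st = "st\<lparr>bufs := (bufs st)(t := (bufs st t)(i := []))\<rparr>"
  have "buffered P (?st\<lparr>applied := applied st @ [(i, bufs st t i)]\<rparr>) x = buffered P ?st x"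
    by (simp add: buffered_def buffered_by_def)
  then show ?case
    using deliver buffered_update[of t P i st "[]" x] by simp
qed

text \<open>Buffers addressed to other owners contain no occurrence of \<open>x\<close>, so
  discarding them costs nothing.\<close>

lemma freq_concat_applied:
  assumes "\<forall>b\<in>set bs. routed P hsh R (fst b) (snd b)"
  shows "freq (concat (map snd (filter (\<lambda>b. fst b = owner P hsh x) bs))) x =
         freq (concat (map snd bs)) x"
  using assms by (induction bs) (auto simp: routed_def intro!: freq_eq_0)

lemma weight_local_stream_le:
  fixes st :: "'a par"
  shows "weight (local_stream st i) \<le> processed_size st"
proof -
  have "weight (concat (map snd (filter (\<lambda>b. fst b = i) bs))) \<le> weight (concat (map snd bs))"
    for bs :: "(nat \<times> 'a stream) list"
    by (induction bs) auto
  then show ?thesis by (simp add: local_stream_def processed_size_def)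
qed

section \<open>The local structure of an owner\<close>

lemma chk_process_append:
  "chk_process prm fp h (S @ T) s = bind_pmf (chk_process prm fp h S s) (chk_process prm fp h T)"
proof (induction S arbitrary: s)
  case Nil
  then show ?case by (simp add: bind_return_pmf)
next
  case (Cons p S)
  then show ?case by (auto simp: bind_assoc_pmf intro!: bind_pmf_cong)
qed

abbreviation local_state :: "nat \<Rightarrow> ('a, 'k) mchk \<Rightarrow> 'k hash \<times> 'k chk" where
  "local_state i m \<equiv> (hashes m i, cells m i)"

lemma refresh_table_simps [simp]:
  "hashes (refresh_table P hsh fp \<phi> x m) = hashes m"
  "cells (refresh_table P hsh fp \<phi> x m) = cells m"
  "local_count P hsh fp (refresh_table P hsh fp \<phi> x m) = local_count P hsh fp m"
  by (simp_all add: refresh_table_def local_count_def fun_eq_iff)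

text \<open>Updates of another cell do not touch cell \<open>i\<close>, so their randomness
  integrates out; refreshing the table changes neither hashes nor cells.\<close>

lemma map_local_state_apply_updates:
  "map_pmf (local_state i) (apply_updates v P hsh prm fp \<phi> j S m) =
   map_pmf (Pair (hashes m i))
     (if j = i then chk_process prm fp (hashes m i) S (cells m i) else return_pmf (cells m i))"
proof (induction S arbitrary: m)
  case Nil
  then show ?case by simp
next
  case (Cons p S)
  then show ?case
    by (cases v) (auto simp: map_bind_pmf Let_def)
qed

lemma map_local_state_apply_buffers:
  "map_pmf (local_state i) (apply_buffers v P hsh prm fp \<phi> bs m) =
   map_pmf (Pair (hashes m i))
     (chk_process prm fp (hashes m i) (concat (map snd (filter (\<lambda>b. fst b = i) bs))) (cells m i))"
proof (induction bs arbitrary: m)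
  case Nil
  then show ?case by simp
next
  case (Cons b bs)
  let ?T = "concat (map snd (filter (\<lambda>b. fst b = i) bs))"
  let ?m = "m\<lparr>size_ctr := size_ctr m + weight (snd b)\<rparr>"
  \<comment> \<open>By the induction hypothesis the law of the remaining run, projected to
    \<open>i\<close>, depends on the intermediate state only through its own projection, so
    projection can be pushed inside the bind.\<close>
  have "map_pmf (local_state i) (apply_buffers v P hsh prm fp \<phi> (b # bs) m) =
      bind_pmf (map_pmf (local_state i) (apply_updates v P hsh prm fp \<phi> (fst b) (snd b) ?m))
        (\<lambda>(h, s). map_pmf (Pair h) (chk_process prm fp h ?T s))"
    by (simp add: map_bind_pmf Cons.IH bind_map_pmf)
  also have "\<dots> = map_pmf (Pair (hashes m i)) (chk_process prm fp (hashes m i)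
      (concat (map snd (filter (\<lambda>b. fst b = i) (b # bs)))) (cells m i))"
    unfolding map_local_state_apply_updates
    by (auto simp: bind_map_pmf chk_process_append map_bind_pmf bind_return_pmf)
  finally show ?case .
qed

lemma map_local_state_mchk_run:
  assumes "i < P"
  shows "map_pmf (local_state i) (mchk_run v P hsh prm fp \<phi> st) =
         chk_run prm fp (local_stream st i)"
proof -
  let ?D = "Pi_pmf {..<P} (\<lambda>_. 0) (\<lambda>_. hash_pmf prm)"
  let ?F = "\<lambda>h. map_pmf (Pair h) (chk_process prm fp h (local_stream st i) chk_empty)"
  have "map_pmf (local_state i) (mchk_run v P hsh prm fp \<phi> st) = bind_pmf ?D (\<lambda>hs. ?F (hs i))"
    by (simp add: mchk_run_def map_bind_pmf map_local_state_apply_buffers local_stream_def)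
  also have "\<dots> = bind_pmf (map_pmf (\<lambda>hs. hs i) ?D) ?F"
    by (simp add: bind_map_pmf)
  \<comment> \<open>The hash functions of the threads form a product law, whose component at
    \<open>i\<close> is the law of a single hash function.\<close>
  also have "map_pmf (\<lambda>hs. hs i) ?D = hash_pmf prm"
    using assms by (simp add: Pi_pmf_component)
  finally show ?thesis by (simp add: chk_run_def map_pmf_def)
qed

section \<open>The global table\<close>

text \<open>Agreement is demanded only when both values exist, so a stale table value is tolerated
  while the item is out of the heavy part. Placement and uniqueness are carried along to make the
  agreement inductive.\<close>

definition table_fresh ::
  "nat \<Rightarrow> ('a \<Rightarrow> nat) \<Rightarrow> ('a \<Rightarrow> 'k) \<Rightarrow> 'a \<Rightarrow> ('a, 'k) mchk \<Rightarrow> bool" where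
  "table_fresh P hsh fp e m \<longleftrightarrow>
     (let i = owner P hsh e in
        well_placed (hashes m i) (fp e) (cells m i) \<and>
        size (key_entries (hashes m i) (fp e) (cells m i)) \<le> 1 \<and>
        (\<forall>c c'. hh_table m e = Some c \<longrightarrow> local_count P hsh fp m e = Some c' \<longrightarrow> c = c'))"

text \<open>An update of \<open>e\<close> overwrites its table value with the current counter.
  Another item of the same owner has another fingerprint and cannot change or create a counter of
  \<open>e\<close>; an item of another owner leaves the cell of \<open>e\<close> alone.\<close>

lemma table_fresh_update:
  assumes "table_fresh P hsh fp e m" "0 < slots prm" "owner P hsh x = j"
    "fp x = fp e \<Longrightarrow> x = e"
    "s \<in> set_pmf (chk_update prm (hashes m j) (fp x) w (cells m j))"
  shows "table_fresh P hsh fp e (refresh_table P hsh fp \<phi> x (m\<lparr>cells := (cells m)(j := s)\<rparr>))"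
proof (cases "x = e")
  case True
  then show ?thesis
    using assms chk_update_own_key[of "hashes m j" "fp e" "cells m j" prm s w]
    by (auto simp: table_fresh_def Let_def) (auto simp: refresh_table_def split: option.splits if_splits)
next
  case x: False
  let ?m = "m\<lparr>cells := (cells m)(j := s)\<rparr>"
  have table: "hh_table (refresh_table P hsh fp \<phi> x ?m) e = hh_table m e"
    using x by (simp add: refresh_table_def)
  show ?thesis
  proof (cases "owner P hsh e = j")
    case True
    then have wp: "well_placed (hashes m j) (fp e) (cells m j)"
      and sz: "size (key_entries (hashes m j) (fp e) (cells m j)) \<le> 1"
      using assms(1) by (auto simp: table_fresh_def Let_def)
    have upd: "well_placed (hashes m j) (fp e) s"
      "key_entries (hashes m j) (fp e) s \<subseteq># key_entries (hashes m j) (fp e) (cells m j)"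
      using chk_update_other_key[OF wp assms(2,5)] assms(4) x by auto
    have "size (key_entries (hashes m j) (fp e) s) \<le> 1"
      using size_mset_mono[OF upd(2)] sz by simp
    moreover have "c = c'"
      if "hh_table m e = Some c" "local_count P hsh fp ?m e = Some c'" for c c'
    proof -
      have "local_count P hsh fp m e = Some c'"
        using heavy_count_antimono[OF sz upd(2)] that(2) True by (simp add: local_count_def)
      with assms(1) that(1) show ?thesis unfolding table_fresh_def Let_def by blast
    qed
    ultimately show ?thesis
      using upd(1) True table by (simp add: table_fresh_def)
  next
    case False
    then have "local_count P hsh fp ?m e = local_count P hsh fp m e"
      by (simp add: local_count_def)
    with False assms(1) table show ?thesis by (simp add: table_fresh_def Let_def)
  qed
qed

lemma table_fresh_apply_updates:
  assumes "table_fresh P hsh fp e m" "0 < slots prm" "routed P hsh R j S" "no_collisions fp R e"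
    "m' \<in> set_pmf (apply_updates MCHK_Q P hsh prm fp \<phi> j S m)"
  shows "table_fresh P hsh fp e m'"
  using assms(1,3,5)
proof (induction S arbitrary: m)
  case Nil
  then show ?case by simp
next
  case (Cons p S)
  have "fp (fst p) = fp e \<Longrightarrow> fst p = e"
    using inj_onD[OF assms(4)[unfolded no_collisions_def], of "fst p" e] Cons.prems(2)
    by (simp add: routed_def)
  moreover have "owner P hsh (fst p) = j" "routed P hsh R j S"
    using Cons.prems(2) by (auto simp: routed_def)
  moreover obtain s where
    "s \<in> set_pmf (chk_update prm (hashes m j) (fp (fst p)) (snd p) (cells m j))"
    "m' \<in> set_pmf (apply_updates MCHK_Q P hsh prm fp \<phi> j S
      (refresh_table P hsh fp \<phi> (fst p) (m\<lparr>cells := (cells m)(j := s)\<rparr>)))"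
    using Cons.prems(3) by (auto simp: Let_def)
  ultimately show ?case
    using Cons.IH table_fresh_update[OF Cons.prems(1) assms(2)] by blast
qed

lemma table_fresh_apply_buffers:
  assumes "table_fresh P hsh fp e m" "0 < slots prm"
    "\<forall>b\<in>set bs. routed P hsh R (fst b) (snd b)" "no_collisions fp R e"
    "m' \<in> set_pmf (apply_buffers MCHK_Q P hsh prm fp \<phi> bs m)"
  shows "table_fresh P hsh fp e m'"
  using assms(1,3,5)
proof (induction bs arbitrary: m)
  case Nil
  then show ?case by simp
next
  case (Cons b bs)
  let ?m = "m\<lparr>size_ctr := size_ctr m + weight (snd b)\<rparr>"
  have "table_fresh P hsh fp e ?m"
    using Cons.prems(1) by (simp add: table_fresh_def local_count_def)
  with Cons assms(2,4) show ?case
    by (auto dest: table_fresh_apply_updates)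
qed

text \<open>The threshold decides whether a value is returned, not which one. Variant I reads the
  counter itself; variant Q starts with an empty table, which is fresh, and stays fresh.\<close>

lemma hh_query_eq_local_count:
  assumes "0 < slots prm" "\<forall>b\<in>set (applied st). routed P hsh R (fst b) (snd b)"
    "no_collisions fp R e" "m \<in> set_pmf (mchk_run v P hsh prm fp \<phi> st)"
    "hh_query v P hsh fp \<theta> m e = Some c" "local_count P hsh fp m e = Some c'"
  shows "c = c'"
proof (cases v)
  case MCHK_I
  with assms(5,6) show ?thesis by (simp add: hh_query_def split: if_splits)
next
  case MCHK_Q
  from assms(4) MCHK_Q obtain hs where
    m: "m \<in> set_pmf (apply_buffers MCHK_Q P hsh prm fp \<phi> (applied st)
        \<lparr>hashes = hs, cells = (\<lambda>_. chk_empty), size_ctr = 0, hh_table = (\<lambda>_. None)\<rparr>)"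
    by (auto simp: mchk_run_def)
  have "table_fresh P hsh fp e m"
    by (rule table_fresh_apply_buffers[OF _ assms(1-3) m]) (simp add: table_fresh_def)
  with assms(5,6) MCHK_Q show ?thesis
    by (auto simp: table_fresh_def Let_def hh_query_def split: option.splits if_splits)
qed

section \<open>Passing to the sequential probability\<close>

lemma cond_prob_le_map_pmf:
  assumes "\<And>m. m \<in> set_pmf M \<Longrightarrow> A m \<Longrightarrow> B (g m) \<Longrightarrow> A' (g m)"
  shows "\<P>(m in measure_pmf M. A m \<bar> B (g m)) \<le> \<P>(r in measure_pmf (map_pmf g M). A' r \<bar> B r)"
proof -
  have "measure_pmf.prob M {m. A m \<and> B (g m)} \<le> measure_pmf.prob M {m. A' (g m) \<and> B (g m)}"
    by (rule measure_pmf.finite_measure_mono_AE) (use assms in \<open>auto simp: AE_measure_pmf_iff\<close>)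
  \<comment> \<open>The conditioning event is the same on both sides, so the denominators agree and
    comparing numerators suffices; if the denominator is 0, both quotients are 0.\<close>
  then show ?thesis
    by (simp add: cond_prob_def vimage_def divide_right_mono)
qed

theorem theorem6p1:
  fixes v :: variant
    and P max_buf max_w :: nat
    and prm :: chk_params
    and fp :: "'a \<Rightarrow> 'k::finite"
    and hsh :: "'a \<Rightarrow> nat"
    and \<phi> \<theta> \<epsilon> :: real
    and st :: "'a par"
    and e :: 'a
  assumes "0 < P" and "0 < max_buf" and "0 < max_w"
    and "valid_params prm"
    and "0 < \<phi>" and "\<phi> < 1"
    and sequential: "chk_error_bound prm fp \<phi>"
    and reachable: "par_reachable P hsh max_buf max_w st"
    and fingerprints: "no_collisions fp (received st) e"
    and space: "\<And>i. i < P \<Longrightarrow> sufficient_space prm fp \<phi> (local_stream st i)"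
    and "0 < \<epsilon>" and "\<epsilon> < 1"
  shows "\<P>(m in measure_pmf (mchk_run v P hsh prm fp \<phi> st).
             (\<exists>c. hh_query v P hsh fp \<theta> m e = Some c \<and>
                  \<epsilon> * real (processed_size st)
                    \<le> \<bar>real c - (real (freq (received st) e) - real (buffered P st e))\<bar>)
           \<bar> local_count P hsh fp m e \<noteq> None)
         \<le> 1 / (\<epsilon> * real (buckets prm))
       \<and> ((\<forall>t<P. buffered_by P st t e \<le> max_w) \<longrightarrow> buffered P st e \<le> P * max_w)"
proof (intro conjI impI)
  let ?i = "owner P hsh e"
  let ?S = "local_stream st ?i"
  let ?err = "\<lambda>r. \<epsilon> * real (weight ?S)
    \<le> \<bar>real (the (heavy_count (fst r) (snd r) (fp e))) - real (freq ?S e)\<bar>"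
  have i: "?i < P" using \<open>0 < P\<close> by (simp add: owner_def)
  have slots: "0 < slots prm" using \<open>valid_params prm\<close> by (simp add: valid_params_def)
  have routed: "\<forall>b\<in>set (applied st). routed P hsh (received st) (fst b) (snd b)"
    using par_reachable_routed[OF reachable] by blast
  have "freq ?S e = freq (concat (map snd (applied st))) e"
    unfolding local_stream_def using routed by (rule freq_concat_applied)
  \<comment> \<open>The target of the estimate is exactly the frequency in the owner's stream, so
    buffering contributes no further error term.\<close>
  then have freq: "real (freq (received st) e) - real (buffered P st e) = real (freq ?S e)"
    using par_reachable_freq[OF reachable \<open>0 < P\<close>, of e] by simp
  have mem: "0 < snd p \<and> fst p \<in> fst ` set (received st)" if "p \<in> set ?S" for p
    using that routed by (auto simp: local_stream_def routed_def)
  have nc: "no_collisions fp ?S e"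
    using fingerprints unfolding no_collisions_def by (rule inj_on_subset) (use mem in blast)
  \<comment> \<open>The condition is written through \<open>local_state\<close> so that it is the
    preimage of the sequential condition.\<close>
  have "\<P>(m in measure_pmf (mchk_run v P hsh prm fp \<phi> st).
             (\<exists>c. hh_query v P hsh fp \<theta> m e = Some c \<and>
                  \<epsilon> * real (processed_size st)
                    \<le> \<bar>real c - (real (freq (received st) e) - real (buffered P st e))\<bar>)
           \<bar> heavy_count (fst (local_state ?i m)) (snd (local_state ?i m)) (fp e) \<noteq> None)
    \<le> \<P>(r in measure_pmf (map_pmf (local_state ?i) (mchk_run v P hsh prm fp \<phi> st)).
          ?err r \<bar> heavy_count (fst r) (snd r) (fp e) \<noteq> None)"
  proof (rule cond_prob_le_map_pmf)
    fix m
    assume m: "m \<in> set_pmf (mchk_run v P hsh prm fp \<phi> st)"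
      and ex: "\<exists>c. hh_query v P hsh fp \<theta> m e = Some c \<and> \<epsilon> * real (processed_size st)
                \<le> \<bar>real c - (real (freq (received st) e) - real (buffered P st e))\<bar>"
      and "heavy_count (fst (local_state ?i m)) (snd (local_state ?i m)) (fp e) \<noteq> None"
    then obtain c' where c': "local_count P hsh fp m e = Some c'"
      by (auto simp: local_count_def)
    from ex obtain c where c: "hh_query v P hsh fp \<theta> m e = Some c"
      "\<epsilon> * real (processed_size st) \<le> \<bar>real c - real (freq ?S e)\<bar>"
      unfolding freq by blast
    have "c = c'"
      using hh_query_eq_local_count[OF slots routed fingerprints m c(1) c'] .
    \<comment> \<open>The global size dominates the local weight, so a deviation beyond the global
      tolerance also exceeds the local one.\<close>
    moreover have "\<epsilon> * real (weight ?S) \<le> \<epsilon> * real (processed_size st)"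
      using \<open>0 < \<epsilon>\<close> weight_local_stream_le[of st ?i] by simp
    ultimately show "?err (local_state ?i m)"
      using c(2) c' by (simp add: local_count_def Let_def)
  qed
  also have "\<dots> \<le> 1 / (\<epsilon> * real (buckets prm))"
    unfolding map_local_state_mchk_run[OF i]
    using sequential[unfolded chk_error_bound_def, rule_format, OF _ nc space[OF i] \<open>0 < \<epsilon>\<close> \<open>\<epsilon> < 1\<close>]
      mem by blast
  finally show "\<P>(m in measure_pmf (mchk_run v P hsh prm fp \<phi> st).
             (\<exists>c. hh_query v P hsh fp \<theta> m e = Some c \<and>
                  \<epsilon> * real (processed_size st)
                    \<le> \<bar>real c - (real (freq (received st) e) - real (buffered P st e))\<bar>)
           \<bar> local_count P hsh fp m e \<noteq> None) \<le> 1 / (\<epsilon> * real (buckets prm))"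
    by (simp add: local_count_def Let_def)
next
  assume "\<forall>t<P. buffered_by P st t e \<le> max_w"
  then show "buffered P st e \<le> P * max_w"
    using sum_bounded_above[of "{..<P}" "\<lambda>t. buffered_by P st t e" max_w]
    by (simp add: buffered_def)
qed

end
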